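(* Let $a,b,c,d\in\mathbb{Z}_{\ge1}$ be pairwise distinct. Put $k_n=3\cdot4^n$, $w_0:=abc$ and $w_{n+1}:=w_n\,adc\,(abc)^{k_n}$ for $n\ge0$ (words in the letters $a,b,c,d$), let $t_n=3(n+4^n)$ be the length of $w_n$, let $w_\infty=\lim w_n$, and let $\alpha=[b_0;b_1,b_2,\ldots]$ be the simple continued fraction whose sequence of partial quotients is $w_\infty$. Let $A_n/B_n$ be the convergents of $\alpha$ and let $D_n$ be the denominator of the $n$th convergent of $\alpha^{-1}=[0;b_0,b_1,\ldots]$. Put $g=\gcd(ab+1,bc+1)$, $t=(ab+1)/g$, $s=(bc+1)/g$, $$\widehat A_2=acd+a+c,\quad\widehat A_1=ad+1,\quad\widehat B_2=cd+1,\quad\widehat B_1=d,$$ and for $h\in\mathbb{Z}_{\ge1}$ $$x_h=s(\widehat B_1A_{t_h-2}+\widehat A_1A_{t_h-1}),\quad y_h=t(\widehat B_2A_{t_h-2}+\widehat A_2A_{t_h-1}),$$ $$z_h=s(\widehat B_1B_{t_h-2}+\widehat A_1B_{t_h-1}),\quad v_h=t(\widehat B_2B_{t_h-2}+\widehat A_2B_{t_h-1}),$$ $$q_h:=x_hB_{t_{h+1}-2}+y_hB_{t_{h+1}-1}=z_hD_{t_{h+1}-1}+v_hD_{t_{h+1}}$$ (the two expressions being equal). Then there exists an effectively determined positive constant $\gamma_4=\gamma_4(a,b,c,d)$, independent of $h$, such that, with $\delta_h:=h\,\dfrac{\log\gamma_4}{\log q_h}$, $$\|q_h\alpha\|\le\frac1{q_h^{3/5-\delta_h}},\qquad\|q_h\alpha^{-1}\|\le\frac1{q_h^{3/5-\delta_h}},\qquad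 q_h\,\|q_h\alpha\|\,\|q_h\alpha^{-1}\|\le\frac1{q_h^{1/5-2\delta_h}}$$ for all $h\in\mathbb{Z}_{\ge1}$. Therefore $\alpha$ and $\alpha^{-1}$ satisfy the Littlewood conjecture, i.e. $\liminf_{q\to\infty}q\,\|q\alpha\|\,\|q\alpha^{-1}\|=0$.
   Context: For real $x$, $\|x\|:=\min_{k\in\mathbb{Z}}|x-k|$; $q$ ranges over positive integers. The convergents $A_n/B_n=[b_0;b_1,\ldots,b_n]$ are given by $A_n=b_nA_{n-1}+A_{n-2}$, $B_n=b_nB_{n-1}+B_{n-2}$ $(n\ge0)$ with $A_{-1}=1$, $B_{-1}=0$, $A_{-2}=0$, $B_{-2}=1$; $D_n$ is given by the same recurrence and initial values applied to the partial quotients $0,b_0,b_1,\ldots$ of $\alpha^{-1}$. Each word $w_n$ is a prefix of $w_{n+1}$, and $w_\infty$ is the infinite word having all $w_n$ as prefixes; $(abc)^k$ denotes the $k$-fold concatenation. In matrix form, $\begin{pmatrix}\widehat A_2&\widehat A_1\\ \widehat B_2&\widehat B_1\end{pmatrix}=\begin{pmatrix}a&1\\1&0\end{pmatrix}\begin{pmatrix}d&1\\1&0\end{pmatrix}\begin{pmatrix}c&1\\1&0\end{pmatrix}$, and $ab+1$, $bc+1$ are the upper right and lower left entries of $\begin{pmatrix}a&1\\1&0\end{pmatrix}\begin{pmatrix}b&1\\1&0\end{pmatrix}\begin{pmatrix}c&1\\1&0\end{pmatrix}$. *)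

theory Defs
  imports "HOL-Analysis.Analysis"
begin

section \<open>Distance to the nearest integer\<close>

definition nint_dist :: "real \<Rightarrow> real" where
  "nint_dist x = (INF k::int. \<bar>x - of_int k\<bar>)"

text \<open>The infimum is a minimum:\<close>

lemma nint_dist_le: "nint_dist x \<le> \<bar>x - of_int k\<bar>"
  unfolding nint_dist_def by (intro cINF_lower bdd_belowI[of _ 0]) auto

lemma nint_dist_attained: "\<exists>k::int. nint_dist x = \<bar>x - of_int k\<bar>"
proof -
  have "nint_dist x \<ge> \<bar>x - of_int (round x)\<bar>"
    unfolding nint_dist_def
    by (intro cINF_greatest) (auto simp: round_diff_minimal)
  with nint_dist_le[of x "round x"] show ?thesis by (intro exI[of _ "round x"]) simp
qed


section \<open>Simple continued fractions\<close>

text \<open>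
  Numerators \<open>A\<^sub>n\<close> and denominators \<open>B\<^sub>n\<close> of the convergents of \<open>[b\<^sub>0; b\<^sub>1, b\<^sub>2, \<dots>]\<close>.
  The auxiliary functions carry an index shift by two:
  \<open>cf_num_shift b n\<close> is \<open>A\<close> with index \<open>n - 2\<close>, so that the initial
  values \<open>A\<^sub>-\<^sub>2 = 0\<close>, \<open>A\<^sub>-\<^sub>1 = 1\<close>, \<open>B\<^sub>-\<^sub>2 = 1\<close>, \<open>B\<^sub>-\<^sub>1 = 0\<close> can be used as they stand.
\<close>

fun cf_num_shift :: "(nat \<Rightarrow> nat) \<Rightarrow> nat \<Rightarrow> nat" where
  "cf_num_shift b 0 = 0"
| "cf_num_shift b (Suc 0) = 1"
| "cf_num_shift b (Suc (Suc n)) = b n * cf_num_shift b (Suc n) + cf_num_shift b n"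

fun cf_den_shift :: "(nat \<Rightarrow> nat) \<Rightarrow> nat \<Rightarrow> nat" where
  "cf_den_shift b 0 = 1"
| "cf_den_shift b (Suc 0) = 0"
| "cf_den_shift b (Suc (Suc n)) = b n * cf_den_shift b (Suc n) + cf_den_shift b n"

definition cf_num :: "(nat \<Rightarrow> nat) \<Rightarrow> nat \<Rightarrow> nat" where
  "cf_num b n = cf_num_shift b (n + 2)"

definition cf_den :: "(nat \<Rightarrow> nat) \<Rightarrow> nat \<Rightarrow> nat" where
  "cf_den b n = cf_den_shift b (n + 2)"

definition cf_value :: "(nat \<Rightarrow> nat) \<Rightarrow> real" where
  "cf_value b = lim (\<lambda>n. real (cf_num b n) / real (cf_den b n))"


section \<open>The words and the number they define\<close>

fun word :: "'a \<Rightarrow> 'a \<Rightarrow> 'a \<Rightarrow> 'a \<Rightarrow> nat \<Rightarrow> 'a list" where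
  "word a b c d 0 = [a, b, c]"
| "word a b c d (Suc n) =
     word a b c d n @ [a, d, c] @ concat (replicate (3 * 4 ^ n) [a, b, c])"

definition word_len :: "nat \<Rightarrow> nat" where
  "word_len n = 3 * (n + 4 ^ n)"

lemma length_word: "length (word a b c d n) = word_len n"
  by (induction n) (auto simp: word_len_def length_concat sum_list_replicate)

text \<open>
  Position \<open>i\<close> of the limit word is read off from the \<open>i\<close>th word, which is longer than \<open>i\<close>;
  the lemma below shows that all \<open>w\<^sub>n\<close> are prefixes of the result.
\<close>

definition word_lim :: "'a \<Rightarrow> 'a \<Rightarrow> 'a \<Rightarrow> 'a \<Rightarrow> nat \<Rightarrow> 'a" where
  "word_lim a b c d i = word a b c d i ! i"

lemma word_nth_mono:
  assumes "m \<le> n" "i < word_len m"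
  shows "word a b c d n ! i = word a b c d m ! i"
  using assms(1)
proof (induction n rule: dec_induct)
  case (step n)
  have "word_len m \<le> word_len n"
    using step.hyps(1) by (simp add: word_len_def add_mono)
  with assms(2) have "i < length (word a b c d n)" by (simp add: length_word)
  then show ?case using step.IH by (simp add: nth_append)
qed simp

lemma word_prefix_word_lim: "map (word_lim a b c d) [0..<word_len n] = word a b c d n"
proof (rule nth_equalityI)
  fix i assume "i < length (map (word_lim a b c d) [0..<word_len n])"
  then have i: "i < word_len n" by simp
  have i': "i < word_len i" by (simp add: word_len_def trans_less_add1)
  show "map (word_lim a b c d) [0..<word_len n] ! i = word a b c d n ! i"
    using word_nth_mono[of i n i a b c d] word_nth_mono[of n i i a b c d] i i'
    by (cases "i \<le> n") (auto simp: word_lim_def)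
qed (simp add: length_word)

definition alpha :: "nat \<Rightarrow> nat \<Rightarrow> nat \<Rightarrow> nat \<Rightarrow> real" where
  "alpha a b c d = cf_value (word_lim a b c d)"

definition A_seq :: "nat \<Rightarrow> nat \<Rightarrow> nat \<Rightarrow> nat \<Rightarrow> nat \<Rightarrow> nat" where
  "A_seq a b c d = cf_num (word_lim a b c d)"

definition B_seq :: "nat \<Rightarrow> nat \<Rightarrow> nat \<Rightarrow> nat \<Rightarrow> nat \<Rightarrow> nat" where
  "B_seq a b c d = cf_den (word_lim a b c d)"

text \<open>Denominators belonging to the partial quotients \<open>0, b\<^sub>0, b\<^sub>1, \<dots>\<close> of \<open>1/\<alpha>\<close>:\<close>

definition D_seq :: "nat \<Rightarrow> nat \<Rightarrow> nat \<Rightarrow> nat \<Rightarrow> nat \<Rightarrow> nat" where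
  "D_seq a b c d = cf_den (case_nat 0 (word_lim a b c d))"


section \<open>The integers \<open>q\<^sub>h\<close>\<close>

text \<open>Both divisions are exact.\<close>

definition t_coef :: "nat \<Rightarrow> nat \<Rightarrow> nat \<Rightarrow> nat" where
  "t_coef a b c = (a * b + 1) div gcd (a * b + 1) (b * c + 1)"

definition s_coef :: "nat \<Rightarrow> nat \<Rightarrow> nat \<Rightarrow> nat" where
  "s_coef a b c = (b * c + 1) div gcd (a * b + 1) (b * c + 1)"

definition A2_hat :: "nat \<Rightarrow> nat \<Rightarrow> nat \<Rightarrow> nat" where
  "A2_hat a c d = a * c * d + a + c"

definition A1_hat :: "nat \<Rightarrow> nat \<Rightarrow> nat" where
  "A1_hat a d = a * d + 1"

definition B2_hat :: "nat \<Rightarrow> nat \<Rightarrow> nat" where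
  "B2_hat c d = c * d + 1"

definition B1_hat :: "nat \<Rightarrow> nat" where
  "B1_hat d = d"

text \<open>Since \<open>word_len h \<ge> 3\<close>, none of the index subtractions below is truncated.\<close>

definition x_seq :: "nat \<Rightarrow> nat \<Rightarrow> nat \<Rightarrow> nat \<Rightarrow> nat \<Rightarrow> nat" where
  "x_seq a b c d h = s_coef a b c *
     (B1_hat d * A_seq a b c d (word_len h - 2) + A1_hat a d * A_seq a b c d (word_len h - 1))"

definition y_seq :: "nat \<Rightarrow> nat \<Rightarrow> nat \<Rightarrow> nat \<Rightarrow> nat \<Rightarrow> nat" where
  "y_seq a b c d h = t_coef a b c *
     (B2_hat c d * A_seq a b c d (word_len h - 2) + A2_hat a c d * A_seq a b c d (word_len h - 1))"

definition z_seq :: "nat \<Rightarrow> nat \<Rightarrow> nat \<Rightarrow> nat \<Rightarrow> nat \<Rightarrow> nat" where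
  "z_seq a b c d h = s_coef a b c *
     (B1_hat d * B_seq a b c d (word_len h - 2) + A1_hat a d * B_seq a b c d (word_len h - 1))"

definition v_seq :: "nat \<Rightarrow> nat \<Rightarrow> nat \<Rightarrow> nat \<Rightarrow> nat \<Rightarrow> nat" where
  "v_seq a b c d h = t_coef a b c *
     (B2_hat c d * B_seq a b c d (word_len h - 2) + A2_hat a c d * B_seq a b c d (word_len h - 1))"

definition q_seq :: "nat \<Rightarrow> nat \<Rightarrow> nat \<Rightarrow> nat \<Rightarrow> nat \<Rightarrow> nat" where
  "q_seq a b c d h =
     x_seq a b c d h * B_seq a b c d (word_len (Suc h) - 2)
   + y_seq a b c d h * B_seq a b c d (word_len (Suc h) - 1)"

definition q_seq_alt :: "nat \<Rightarrow> nat \<Rightarrow> nat \<Rightarrow> nat \<Rightarrow> nat \<Rightarrow> nat" where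
  "q_seq_alt a b c d h =
     z_seq a b c d h * D_seq a b c d (word_len (Suc h) - 1)
   + v_seq a b c d h * D_seq a b c d (word_len (Suc h))"


section \<open>Effectively determined constants\<close>

text \<open>
  \<open>total_recursive n f\<close>: the \<open>n\<close>-ary function \<open>f\<close> is total recursive. Arguments are passed as
  lists of length \<open>n\<close>; the values on lists of other lengths are immaterial. The rule \<open>mu\<close> is
  minimization of regular functions, so only total functions arise.
\<close>

inductive total_recursive :: "nat \<Rightarrow> (nat list \<Rightarrow> nat) \<Rightarrow> bool" where
  zero: "total_recursive n (\<lambda>xs. 0)"
| succ: "total_recursive 1 (\<lambda>xs. Suc (xs ! 0))"
| proj: "i < n \<Longrightarrow> total_recursive n (\<lambda>xs. xs ! i)"
| comp: "total_recursive (length gs) f \<Longrightarrow> (\<forall>g\<in>set gs. total_recursive n g) \<Longrightarrow>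
    total_recursive n (\<lambda>xs. f (map (\<lambda>g. g xs) gs))"
| prim_rec: "total_recursive n f \<Longrightarrow> total_recursive (n + 2) g \<Longrightarrow>
    total_recursive (Suc n) (\<lambda>xs. rec_nat (f (tl xs)) (\<lambda>k r. g (k # r # tl xs)) (hd xs))"
| mu: "total_recursive (Suc n) f \<Longrightarrow> (\<forall>xs. length xs = n \<longrightarrow> (\<exists>k. f (k # xs) = 0)) \<Longrightarrow>
    total_recursive n (\<lambda>xs. LEAST k. f (k # xs) = 0)"

text \<open>
  A nonnegative real depending on four natural parameters is effectively determined if it can be
  computed from them to any prescribed accuracy \<open>1 / (m + 1)\<close>, by one algorithm for all parameters.
\<close>

definition effectively_determined :: "(nat \<Rightarrow> nat \<Rightarrow> nat \<Rightarrow> nat \<Rightarrow> real) \<Rightarrow> bool" where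
  "effectively_determined \<gamma> \<longleftrightarrow>
     (\<exists>f. total_recursive 5 f \<and>
       (\<forall>a b c d m. \<bar>\<gamma> a b c d - real (f [a, b, c, d, m]) / real (Suc m)\<bar> \<le> 1 / real (Suc m)))"

end

theory Submission
  imports Defs "HOL-Real_Asymp.Real_Asymp"
begin

text \<open>
  Let \<open>M\<close> be the matrix of the block \<open>abc\<close>, \<open>W\<^sub>h\<close> that of \<open>w\<^sub>h\<close>, and \<open>T\<close> that of \<open>w\<^sub>h adc\<close>, so that
  \<open>W\<^sub>h\<^sub>+\<^sub>1 = T M\<^sup>k\<close>. Every power of \<open>M\<close> lies in the span of \<open>M\<close> and the identity, hence becomes
  symmetric after multiplication by the diagonal matrix with entries \<open>t, s\<close>. This makes \<open>q\<^sub>h\<close> a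
  combination, with coefficients of the size of \<open>W\<^sub>h\<close>, both of the last two denominators of \<open>\<alpha>\<close>
  belonging to \<open>w\<^sub>h\<^sub>+\<^sub>1\<close> and of those of \<open>1/\<alpha>\<close>. With \<open>X\<^sub>h\<close> the upper left entry of \<open>W\<^sub>h\<close>, both
  distances are therefore \<open>O(X\<^sub>h / X\<^sub>h\<^sub>+\<^sub>1)\<close>, while \<open>q\<^sub>h = O(X\<^sub>h X\<^sub>h\<^sub>+\<^sub>1)\<close>.

  Continuants are multiplicative under concatenation up to a factor between 1 and 2, and \<open>w\<^sub>h\<close>
  consists of \<open>4\<^sup>h\<close> blocks \<open>abc\<close> and only \<open>h\<close> blocks \<open>adc\<close>. Hence \<open>X\<^sub>h\<^sup>4 \<le> C\<^sup>3\<^sup>h X\<^sub>h\<^sub>+\<^sub>1\<close> for a constant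
  \<open>C\<close>, which turns the above bounds into the claimed exponents.
\<close>

section \<open>Convergents and approximation\<close>

lemma cf_den_pos:
  assumes "\<And>n. b n \<ge> 1"
  shows "cf_den b n > 0"
proof -
  \<comment> \<open>Two consecutive denominators are carried through the induction, starting past
    the value at index -1, which is zero.\<close>
  have "cf_den_shift b (Suc (Suc n)) \<ge> 1 \<and> cf_den_shift b (Suc (Suc (Suc n))) \<ge> 1"
  proof (induction n)
    case 0
    show ?case using assms[of 1] by simp
  next
    case (Suc n)
    have "1 * 1 \<le> b (Suc (Suc n)) * cf_den_shift b (Suc (Suc (Suc n)))"
      by (rule mult_le_mono[OF assms conjunct2[OF Suc.IH]])
    then show ?case using Suc cf_den_shift.simps(3)[of b "Suc (Suc n)"] by linarith
  qed
  then show ?thesis by (simp add: cf_den_def del: cf_den_shift.simps)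
qed

lemma cf_den_Suc_Suc: "cf_den b (Suc (Suc n)) = b (Suc (Suc n)) * cf_den b (Suc n) + cf_den b n"
  by (simp add: cf_den_def)

lemma cf_den_mono:
  assumes "\<And>n. b n \<ge> 1"
  shows "cf_den b n \<le> cf_den b (Suc n)"
proof (cases n)
  case 0
  then show ?thesis using assms[of 1] by (simp add: cf_den_def numeral_eq_Suc)
next
  case (Suc m)
  have "1 * cf_den b (Suc m) \<le> b (Suc (Suc m)) * cf_den b (Suc m)"
    by (intro mult_right_mono assms) simp
  then show ?thesis unfolding Suc cf_den_Suc_Suc by linarith
qed

lemma cf_den_ge:
  assumes "\<And>n. b n \<ge> 1"
  shows "cf_den b n \<ge> n"
proof (induction n rule: less_induct)
  case (less n)
  consider "n = 0" | "n = 1" | m where "n = Suc (Suc m)"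
    by (metis One_nat_def not0_implies_Suc)
  then show ?case
  proof cases
    case 2
    then show ?thesis using cf_den_pos[of b 1] assms by simp
  next
    case 3
    have "1 * cf_den b (Suc m) \<le> b (Suc (Suc m)) * cf_den b (Suc m)"
      by (intro mult_right_mono assms) simp
    moreover have "Suc m \<le> cf_den b (Suc m)" using less 3 by simp
    moreover have "cf_den b m > 0" using cf_den_pos assms by simp
    ultimately show ?thesis unfolding 3 cf_den_Suc_Suc by linarith
  qed simp
qed

text \<open>One step of the recurrence exchanges the two columns up to a column operation, so the
  determinant only changes sign. Integers are used because it is alternately negative.\<close>

lemma cf_det_shift:
  "int (cf_num_shift b (Suc n)) * int (cf_den_shift b n)
     - int (cf_num_shift b n) * int (cf_den_shift b (Suc n)) = (-1) ^ n"
proof (induction n)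
  case (Suc n)
  have "int (cf_num_shift b (Suc (Suc n))) * int (cf_den_shift b (Suc n))
      - int (cf_num_shift b (Suc n)) * int (cf_den_shift b (Suc (Suc n)))
      = - (int (cf_num_shift b (Suc n)) * int (cf_den_shift b n)
            - int (cf_num_shift b n) * int (cf_den_shift b (Suc n)))"
    by (simp add: algebra_simps)
  then show ?case unfolding Suc.IH by simp
qed simp

lemma convergent_diff:
  assumes "\<And>n. b n \<ge> 1"
  shows "real (cf_num b (Suc n)) / real (cf_den b (Suc n)) - real (cf_num b n) / real (cf_den b n)
     = (-1) ^ n * (1 / (real (cf_den b n) * real (cf_den b (Suc n))))"
proof -
  have "real_of_int (int (cf_num b (Suc n)) * int (cf_den b n) - int (cf_num b n) * int (cf_den b (Suc n)))
      = (-1) ^ n"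
    using cf_det_shift[of b "n + 2"] by (simp add: cf_num_def cf_den_def)
  then have "real (cf_num b (Suc n)) * real (cf_den b n) - real (cf_num b n) * real (cf_den b (Suc n))
      = (-1) ^ n" by simp
  then show ?thesis
    using cf_den_pos[of b n] cf_den_pos[of b "Suc n"] assms by (simp add: field_simps)
qed

text \<open>Telescoping turns the convergents into partial sums of an alternating series with
  decreasing terms \<open>1 / (B n * B (Suc n))\<close>. Leibniz's criterion then gives both
  convergence, so that the \<open>lim\<close> in \<open>cf_value\<close> is a genuine limit, and the
  enclosure by even and odd convergents.\<close>

lemma cf_value_between:
  assumes b: "\<And>n. b n \<ge> 1"
  shows "real (cf_num b (2 * n)) / real (cf_den b (2 * n)) \<le> cf_value b"
    and "cf_value b \<le> real (cf_num b (2 * n + 1)) / real (cf_den b (2 * n + 1))"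
proof -
  define c where "c n = real (cf_num b n) / real (cf_den b n)" for n
  define u where "u n = 1 / (real (cf_den b n) * real (cf_den b (Suc n)))" for n
  have pos: "cf_den b n > 0" for n using cf_den_pos b by simp
  have c: "c n = c 0 + (\<Sum>i<n. (-1) ^ i * u i)" for n
  proof (induction n)
    case (Suc n)
    then show ?case using convergent_diff[of b n] b by (simp add: c_def u_def algebra_simps)
  qed simp
  have u0: "u n \<ge> 0" for n by (simp add: u_def)
  \<comment> \<open>The linear bound \<open>cf_den_ge\<close> is enough for the terms to tend to
    zero.\<close>
  have "u n \<le> 1 / real n" if "n > 0" for n
  proof -
    have "real n * 1 \<le> real (cf_den b n) * real (cf_den b (Suc n))"
      using cf_den_ge[of b n] b pos[of "Suc n"] by (intro mult_mono) auto
    then show ?thesis using that by (simp add: u_def divide_left_mono)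
  qed
  then have lim: "u \<longlonglongrightarrow> 0"
    by (intro tendsto_sandwich[OF _ _ tendsto_const lim_1_over_n])
       (auto simp: u0 intro!: eventually_mono[OF eventually_gt_at_top[of 0]])
  have mono: "u (Suc n) \<le> u n" for n
  proof -
    have "cf_den b n \<le> cf_den b (Suc n)" "cf_den b (Suc n) \<le> cf_den b (Suc (Suc n))"
      using cf_den_mono b by auto
    then have "real (cf_den b n) * real (cf_den b (Suc n)) \<le> real (cf_den b (Suc n)) * real (cf_den b (Suc (Suc n)))"
      by (intro mult_mono) auto
    then show ?thesis unfolding u_def using pos by (intro divide_left_mono) auto
  qed
  note L = summable_Leibniz'(1,2,4)[of u, OF lim u0 mono]
  have "(\<lambda>n. c 0 + (\<Sum>i<n. (-1) ^ i * u i)) \<longlonglongrightarrow> c 0 + (\<Sum>i. (-1) ^ i * u i)"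
    by (intro tendsto_intros summable_LIMSEQ L)
  then have "c \<longlonglongrightarrow> c 0 + (\<Sum>i. (-1) ^ i * u i)" unfolding c[symmetric] .
  then have "cf_value b = c 0 + (\<Sum>i. (-1) ^ i * u i)"
    unfolding cf_value_def c_def[symmetric] by (intro limI)
  then have "c (2 * n) \<le> cf_value b" "cf_value b \<le> c (2 * n + 1)"
    using L(2,3)[of n] c[of "2 * n"] c[of "2 * n + 1"] by linarith+
  then show "real (cf_num b (2 * n)) / real (cf_den b (2 * n)) \<le> cf_value b"
    "cf_value b \<le> real (cf_num b (2 * n + 1)) / real (cf_den b (2 * n + 1))"
    by (simp_all add: c_def)
qed

text \<open>The value lies between two consecutive convergents, hence is no farther from the first
  than the second is.\<close>

lemma cf_approx:
  assumes b: "\<And>n. b n \<ge> 1"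
  shows "\<bar>real (cf_den b n) * cf_value b - real (cf_num b n)\<bar> \<le> 1 / real (cf_den b (Suc n))"
proof -
  define c where "c n = real (cf_num b n) / real (cf_den b n)" for n
  have pos: "cf_den b n > 0" for n using cf_den_pos b by simp
  have "\<bar>cf_value b - c n\<bar> \<le> \<bar>c (Suc n) - c n\<bar>"
  proof (cases "even n")
    case True
    then obtain m where "n = 2 * m" by blast
    then show ?thesis using cf_value_between[of b m] b by (simp add: c_def)
  next
    case False
    then obtain m where m: "n = 2 * m + 1" by (auto elim: oddE)
    show ?thesis
      using cf_value_between(2)[of b m] cf_value_between(1)[of b "m + 1"] b
      by (simp add: c_def m)
  qed
  also have "\<dots> = 1 / (real (cf_den b n) * real (cf_den b (Suc n)))"
    using convergent_diff[of b n] b by (simp add: c_def abs_mult)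
  finally have "real (cf_den b n) * \<bar>cf_value b - c n\<bar>
      \<le> real (cf_den b n) * (1 / (real (cf_den b n) * real (cf_den b (Suc n))))"
    by (intro mult_left_mono) auto
  also have "\<dots> = 1 / real (cf_den b (Suc n))" using pos[of n] by simp
  also have "real (cf_den b n) * \<bar>cf_value b - c n\<bar> = \<bar>real (cf_den b n) * cf_value b - real (cf_num b n)\<bar>"
    using pos[of n] by (simp add: c_def abs_mult_pos' right_diff_distrib)
  finally show ?thesis .
qed

lemma cf_value_ge: "cf_value b \<ge> real (b 0)" if "\<And>n. b n \<ge> 1"
  using cf_value_between(1)[of b 0] that by (simp add: cf_num_def cf_den_def numeral_eq_Suc)

text \<open>A leading partial quotient 0 inverts the number and so exchanges numerators and
  denominators; in unshifted indices, \<open>D n\<close> equals \<open>A (n - 1)\<close>.\<close>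

lemma cf_den_shift_case_nat: "cf_den_shift (case_nat 0 b) (Suc n) = cf_num_shift b n"
  by (induction b n rule: cf_num_shift.induct) simp_all

section \<open>Continuant matrices\<close>

text \<open>The quadruple \<open>(p, q, r, s)\<close> stands for the matrix with rows \<open>(p, q)\<close> and \<open>(r, s)\<close>.\<close>

type_synonym mat2 = "nat \<times> nat \<times> nat \<times> nat"

fun mmul :: "mat2 \<Rightarrow> mat2 \<Rightarrow> mat2" where
  "mmul (p, q, r, s) (p', q', r', s') =
     (p * p' + q * r', p * q' + q * s', r * p' + s * r', r * q' + s * s')"

fun cf_mat :: "nat list \<Rightarrow> mat2" where
  "cf_mat [] = (1, 0, 0, 1)"
| "cf_mat (x # xs) = mmul (x, 1, 1, 0) (cf_mat xs)"

definition continuant :: "nat list \<Rightarrow> nat" where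
  "continuant u = fst (cf_mat u)"

lemma mmul_assoc: "mmul (mmul A B) C = mmul A (mmul B C)"
  by (cases A; cases B; cases C) (simp add: algebra_simps)

lemma mmul_id: "mmul (1, 0, 0, 1) A = A" 
  by (cases A) simp

lemma cf_mat_append: "cf_mat (u @ v) = mmul (cf_mat u) (cf_mat v)"
  by (induction u) (simp_all only: append.simps cf_mat.simps mmul_assoc mmul_id)

lemma cf_mat_map:
  "cf_mat (map b [0..<n]) =
     (cf_num_shift b (Suc n), cf_num_shift b n, cf_den_shift b (Suc n), cf_den_shift b n)"
  by (induction n) (simp_all add: cf_mat_append mult.commute)

text \<open>Left multiplication by the matrix of a positive letter preserves these inequalities. The
  last one says that the finite continued fraction \<open>p / r\<close> is at most its first letter
  plus one; for the words it allows denominators to be replaced by numerators at the cost of a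
  factor \<open>a + 1\<close>.\<close>

lemma cf_mat_bounds:
  assumes "u \<noteq> []" "\<forall>x\<in>set u. x \<ge> 1" "cf_mat u = (p, q, r, s)"
  shows "1 \<le> p \<and> q \<le> p \<and> r \<le> p \<and> s \<le> q \<and> s \<le> r \<and> 1 \<le> r \<and> p \<le> Suc (hd u) * r"
  using assms
proof (induction u arbitrary: p q r s rule: list_nonempty_induct)
  case (single x)
  then show ?case by auto
next
  case (cons x xs)
  obtain p' q' r' s' where m: "cf_mat xs = (p', q', r', s')" by (metis prod_cases4)
  have x: "x \<ge> 1" and xs: "\<forall>x\<in>set xs. x \<ge> 1" using cons.prems(1) by simp_all
  note IH = cons.IH[OF xs m]
  have eq: "p = x * p' + r'" "q = x * q' + s'" "r = p'" "s = q'"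
    using cons.prems(2) m by auto
  obtain y where y: "x = Suc y" using x by (cases x) auto
  have "y * q' \<le> y * p'" using IH by (intro mult_le_mono2) blast
  then have "1 \<le> x * p' + r'" "x * q' + s' \<le> x * p' + r'" "p' \<le> x * p' + r'"
    "q' \<le> x * q' + s'" "x * p' + r' \<le> Suc x * p'"
    using IH unfolding y mult_Suc by linarith+
  then show ?case using IH unfolding eq list.sel by blast
qed

lemma continuant_pos:
  assumes "u \<noteq> []" "\<forall>x\<in>set u. x \<ge> 1"
  shows "continuant u \<ge> 1"
proof -
  obtain p q r s where u: "cf_mat u = (p, q, r, s)" by (metis prod_cases4)
  show ?thesis using cf_mat_bounds[OF assms u] by (simp add: continuant_def u)
qed

text \<open>The upper left entry of the product is \<open>p * p' + q * r'\<close>. Dropping the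
  second summand gives this bound; estimating it by \<open>p * p'\<close> gives the factor 2 in
  \<open>continuant_append_le\<close>.\<close>

lemma continuant_append_ge: "continuant u * continuant v \<le> continuant (u @ v)"
  unfolding continuant_def cf_mat_append by (cases "cf_mat u"; cases "cf_mat v") simp

lemma continuant_append_le:
  assumes "u \<noteq> []" "\<forall>x\<in>set u. x \<ge> 1" "v \<noteq> []" "\<forall>x\<in>set v. x \<ge> 1"
  shows "continuant (u @ v) \<le> 2 * continuant u * continuant v"
proof -
  obtain p q r s where u: "cf_mat u = (p, q, r, s)" by (metis prod_cases4)
  obtain p' q' r' s' where v: "cf_mat v = (p', q', r', s')" by (metis prod_cases4)
  have "q * r' \<le> p * p'"
    using cf_mat_bounds[OF assms(1,2) u] cf_mat_bounds[OF assms(3,4) v] by (intro mult_mono) auto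
  then show ?thesis by (simp add: continuant_def cf_mat_append u v mult.commute)
qed

lemma cf_mat_triple: "cf_mat [x, y, z] = (x * y * z + x + z, x * y + 1, y * z + 1, y)"
  by (simp add: algebra_simps)

text \<open>Cayley--Hamilton: the matrix of \<open>abc\<close> has determinant \<open>-1\<close>, so no subtraction occurs.\<close>

lemma cf_mat_power:
  "\<exists>u v. cf_mat (concat (replicate k [a, b, c])) =
     (u * (a * b * c + a + c) + v, u * (a * b + 1), u * (b * c + 1), u * b + v)"
proof (induction k)
  case 0
  show ?case by (rule exI[of _ 0], rule exI[of _ 1]) simp
next
  case (Suc k)
  then obtain u v where uv: "cf_mat (concat (replicate k [a, b, c])) =
     (u * (a * b * c + a + c) + v, u * (a * b + 1), u * (b * c + 1), u * b + v)" by blast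
  have "cf_mat (concat (replicate (Suc k) [a, b, c])) =
      mmul (cf_mat [a, b, c]) (cf_mat (concat (replicate k [a, b, c])))"
    unfolding cf_mat_append[symmetric] by simp
  \<comment> \<open>With M the matrix of abc, M^2 = tr(M) M + 1, so M (u M + v) = (u tr(M) + v) M +
    u.\<close>
  also have "\<dots> = (u' * (a * b * c + a + c) + u, u' * (a * b + 1), u' * (b * c + 1), u' * b + u)"
    if "u' = u * (a * b * c + a + c + b) + v" for u'
    unfolding that uv cf_mat_triple mmul.simps prod.inject
    by (intro conjI; simp add: algebra_simps)
  finally show ?case by blast
qed

text \<open>Both sides are (ab+1)(bc+1)/g. Equivalently, the matrix of abc multiplied on the right
  by diag(t, s) is symmetric.\<close>

lemma coef_identity: "t_coef a b c * (b * c + 1) = s_coef a b c * (a * b + 1)"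
  unfolding t_coef_def s_coef_def
  by (subst (1 2) dvd_div_mult) (simp_all add: mult.commute)

section \<open>Growth of the continuants of the words\<close>

locale positive_letters =
  fixes a b c d :: nat
  assumes pos: "a \<ge> 1" "b \<ge> 1" "c \<ge> 1" "d \<ge> 1"
begin

lemma word_pos: "\<forall>x\<in>set (word a b c d h). x \<ge> 1"
  using pos by (induction h) (auto)

lemma word_nonempty: "word a b c d h \<noteq> []"
  by (induction h) auto

lemma hd_word: "hd (word a b c d h) = a"
  by (induction h) (auto simp: word_nonempty)

lemma word_lim_pos: "word_lim a b c d i \<ge> 1"
proof -
  have "i < length (word a b c d i)" by (simp add: length_word word_len_def trans_less_add1)
  then show ?thesis unfolding word_lim_def using word_pos nth_mem by blast
qed

lemma word_len_ge: "word_len h \<ge> 3"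
proof -
  have "3 * (0 + 1) \<le> word_len h"
    unfolding word_len_def by (intro mult_le_mono2 add_mono) auto
  then show ?thesis by simp
qed

lemma cf_mat_word:
  "cf_mat (word a b c d h) =
     (A_seq a b c d (word_len h - 1), A_seq a b c d (word_len h - 2),
      B_seq a b c d (word_len h - 1), B_seq a b c d (word_len h - 2))"
proof -
  have "word_len h - 1 + 2 = Suc (word_len h)" "word_len h - 2 + 2 = word_len h"
    using word_len_ge[of h] by auto
  then show ?thesis
    unfolding A_seq_def B_seq_def cf_num_def cf_den_def word_prefix_word_lim[symmetric]
    by (simp add: cf_mat_map)
qed

abbreviation "W \<equiv> \<lambda>h. continuant (word a b c d h)"
abbreviation "R \<equiv> \<lambda>k. continuant (concat (replicate k [a, b, c]))"
abbreviation "Q \<equiv> A2_hat a c d"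

lemma continuant_adc: "continuant [a, d, c] = Q"
  by (simp add: continuant_def A2_hat_def algebra_simps)

lemma Q_pos: "Q \<ge> 1" using pos by (simp add: A2_hat_def)

lemma period_pos: "\<forall>x\<in>set (concat (replicate k [a, b, c])). x \<ge> 1"
  using pos by auto

lemma R_add_ge: "R j * R k \<le> R (j + k)"
  using continuant_append_ge by (simp add: replicate_add)

lemma W_Suc_ge: "W h * R (3 * 4 ^ h) \<le> W (Suc h)"
proof -
  have "W h * 1 * R (3 * 4 ^ h) \<le> W h * Q * R (3 * 4 ^ h)"
    using Q_pos by (intro mult_mono) auto
  also have "\<dots> \<le> continuant (word a b c d h @ [a, d, c]) * R (3 * 4 ^ h)"
    using continuant_append_ge[of "word a b c d h" "[a, d, c]"]
    by (intro mult_right_mono) (simp_all add: continuant_adc)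
  also have "\<dots> \<le> W (Suc h)"
    using continuant_append_ge[of "word a b c d h @ [a, d, c]"] by simp
  finally show ?thesis by simp
qed

lemma W_adc_le: "continuant (word a b c d h @ [a, d, c]) \<le> 2 * Q * W h"
  using continuant_append_le[OF word_nonempty word_pos, of "[a, d, c]" h] pos
  by (simp add: continuant_adc algebra_simps)

lemma W_Suc_le: "W (Suc h) \<le> 4 * Q * W h * R (3 * 4 ^ h)"
proof -
  let ?u = "word a b c d h @ [a, d, c]"
  have "W (Suc h) \<le> 2 * continuant ?u * R (3 * 4 ^ h)"
    using continuant_append_le[of ?u "concat (replicate (3 * 4 ^ h) [a, b, c])"]
      word_pos pos period_pos by auto
  also have "\<dots> \<le> 2 * (2 * Q * W h) * R (3 * 4 ^ h)"
    using W_adc_le by (intro mult_mono) auto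
  finally show ?thesis by (simp add: algebra_simps)
qed

text \<open>Each step costs \<open>4 * Q\<close>: the continuant \<open>Q\<close> of adc and a
  factor 2 for each of the two joins. Superadditivity of \<open>R\<close> in the exponent collects
  all blocks abc into a single power, as 4^h + 3*4^h = 4^(h+1).\<close>

lemma W_le: "W h \<le> (4 * Q) ^ h * R (4 ^ h)"
proof (induction h)
  case (Suc h)
  have "W (Suc h) \<le> 4 * Q * W h * R (3 * 4 ^ h)" by (rule W_Suc_le)
  also have "\<dots> \<le> 4 * Q * ((4 * Q) ^ h * R (4 ^ h)) * R (3 * 4 ^ h)"
    using Suc by (intro mult_right_mono mult_left_mono) auto
  also have "\<dots> = (4 * Q) ^ Suc h * (R (4 ^ h) * R (3 * 4 ^ h))" by (simp add: algebra_simps)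
  also have "\<dots> \<le> (4 * Q) ^ Suc h * R (4 ^ h + 3 * 4 ^ h)"
    by (intro mult_left_mono R_add_ge) simp
  finally show ?case by simp
qed simp

text \<open>Three of the four factors \<open>W h\<close> are traded for \<open>R (4 ^ h)\<close> at
  a cost of \<open>(4 * Q) ^ h\<close> each. Their product is at most \<open>R (3 * 4 ^ h)\<close>,
  the continuant of the blocks appended to \<open>w_h\<close>; the fourth factor stays and accounts
  for \<open>w_h\<close> itself.\<close>

lemma W_power4_le: "W h ^ 4 \<le> (4 * Q) ^ (3 * h) * W (Suc h)"
proof -
  let ?k = "4 ^ h :: nat"
  have "R ?k ^ 3 = R ?k * R ?k * R ?k" by (simp add: numeral_eq_Suc)
  also have "\<dots> \<le> R (?k + ?k) * R ?k" by (intro mult_right_mono R_add_ge) simp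
  also have "\<dots> \<le> R (?k + ?k + ?k)" by (rule R_add_ge)
  also have "?k + ?k + ?k = 3 * ?k" by simp
  finally have r: "R ?k ^ 3 \<le> R (3 * ?k)" .
  have "W h ^ 4 = W h ^ 3 * W h" by (simp add: numeral_eq_Suc)
  also have "\<dots> \<le> ((4 * Q) ^ h * R ?k) ^ 3 * W h"
    by (intro mult_right_mono power_mono W_le) auto
  also have "\<dots> = (4 * Q) ^ (3 * h) * (R ?k ^ 3 * W h)"
    by (simp add: power_mult_distrib mult.commute[of 3] power_mult)
  also have "\<dots> \<le> (4 * Q) ^ (3 * h) * (R (3 * ?k) * W h)"
    using r by (intro mult_left_mono mult_right_mono) auto
  also have "\<dots> \<le> (4 * Q) ^ (3 * h) * W (Suc h)"
    using W_Suc_ge[of h] by (intro mult_left_mono) (auto simp: mult.commute)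
  finally show ?thesis .
qed

text \<open>Each of the 4^h blocks abc contributes at least a factor 2. This doubly exponential
  growth later beats the powers of the constant.\<close>

lemma W_ge: "2 ^ 4 ^ h \<le> W h"
proof -
  have R1: "R 1 \<ge> 2" using pos by (auto simp: continuant_def)
  have Rk: "2 ^ k \<le> R k" for k
  proof (induction k)
    case (Suc k)
    have "(2::nat) ^ Suc k = 2 * 2 ^ k" by simp
    also have "\<dots> \<le> R 1 * R k" using R1 Suc by (intro mult_mono) auto
    also have "\<dots> \<le> R (Suc k)" using R_add_ge[of 1 k] by simp
    finally show ?case .
  qed (simp add: continuant_def)
  show ?thesis
  proof (induction h)
    case 0
    then show ?case using R1 by simp
  next
    case (Suc h)
    have "(2::nat) ^ 4 ^ Suc h = 2 ^ 4 ^ h * 2 ^ (3 * 4 ^ h)" by (simp flip: power_add)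
    also have "\<dots> \<le> W h * R (3 * 4 ^ h)" using Suc Rk by (intro mult_mono) auto
    finally show ?case using W_Suc_ge[of h] by simp
  qed
qed

end

section \<open>Two expressions for \<open>q\<^sub>h\<close>\<close>

text \<open>Let S be the matrix with rows (r1, r2) and (r3, r4), and D = diag(t, s). The assumption
  says that S D is symmetric. Then T S D T^t, with T^t the transpose, is symmetric too, and the two
  sides are its lower left and upper right entries.\<close>

lemma twisted_symmetry:
  fixes s t :: nat
  assumes "t * r3 = s * r2"
  shows "s * T12 * (T21 * r2 + T22 * r4) + t * T11 * (T21 * r1 + T22 * r3)
       = s * T22 * (T11 * r2 + T12 * r4) + t * T21 * (T11 * r1 + T12 * r3)"
proof -
  let ?r = "s * T12 * T22 * r4 + t * T11 * T21 * r1"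
  have "s * T12 * (T21 * r2 + T22 * r4) + t * T11 * (T21 * r1 + T22 * r3)
      = T12 * T21 * (s * r2) + T11 * T22 * (t * r3) + ?r" by (simp add: algebra_simps)
  also have "\<dots> = T12 * T21 * (t * r3) + T11 * T22 * (s * r2) + ?r" by (simp only: assms)
  also have "\<dots> = s * T22 * (T11 * r2 + T12 * r4) + t * T21 * (T11 * r1 + T12 * r3)"
    by (simp add: algebra_simps)
  finally show ?thesis .
qed

lemma nint_dist_nonneg: "nint_dist x \<ge> 0"
  using nint_dist_attained[of x] by auto

context positive_letters
begin

lemma D_seq_eq:
  "D_seq a b c d (word_len h - 1) = A_seq a b c d (word_len h - 2)"
  "D_seq a b c d (word_len h) = A_seq a b c d (word_len h - 1)"
proof -
  obtain k where k: "word_len h = Suc (Suc k)"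
    using word_len_ge[of h] that[of "word_len h - 2"] by simp
  show "D_seq a b c d (word_len h - 1) = A_seq a b c d (word_len h - 2)"
    "D_seq a b c d (word_len h) = A_seq a b c d (word_len h - 1)"
    using cf_den_shift_case_nat[of "word_lim a b c d" "Suc (Suc k)"]
      cf_den_shift_case_nat[of "word_lim a b c d" "Suc (Suc (Suc k))"]
    unfolding D_seq_def A_seq_def cf_num_def cf_den_def k by simp_all
qed

text \<open>These are the entries of the matrix T of \<open>w_h\<close> followed by adc, the hatted
  numbers being the entries for adc alone. Thus x_h = s T12, y_h = t T11, z_h = s T22 and v_h = t
  T21.\<close>

abbreviation "T11 h \<equiv> B2_hat c d * A_seq a b c d (word_len h - 2) + A2_hat a c d * A_seq a b c d (word_len h - 1)"
abbreviation "T12 h \<equiv> B1_hat d * A_seq a b c d (word_len h - 2) + A1_hat a d * A_seq a b c d (word_len h - 1)"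
abbreviation "T21 h \<equiv> B2_hat c d * B_seq a b c d (word_len h - 2) + A2_hat a c d * B_seq a b c d (word_len h - 1)"
abbreviation "T22 h \<equiv> B1_hat d * B_seq a b c d (word_len h - 2) + A1_hat a d * B_seq a b c d (word_len h - 1)"

lemma cf_mat_word_adc: "cf_mat (word a b c d h @ [a, d, c]) = (T11 h, T12 h, T21 h, T22 h)"
  by (simp add: cf_mat_append[of "word a b c d h"] cf_mat_word
      A2_hat_def A1_hat_def B2_hat_def B1_hat_def algebra_simps)

text \<open>The matrix of \<open>w_(h+1)\<close> is T M^k with k = 3*4^h, and
  \<open>D_seq_eq\<close> turns the \<open>D\<close> into numerators. The two expressions then
  become the two sides of \<open>twisted_symmetry\<close> for S = M^k.\<close>

lemma q_seq_eq_alt: "q_seq a b c d h = q_seq_alt a b c d h"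
proof -
  obtain u v where R: "cf_mat (concat (replicate (3 * 4 ^ h) [a, b, c])) =
     (u * (a * b * c + a + c) + v, u * (a * b + 1), u * (b * c + 1), u * b + v)"
    using cf_mat_power by blast
  have sym: "t_coef a b c * (u * (b * c + 1)) = s_coef a b c * (u * (a * b + 1))"
    using coef_identity[of a b c] by (metis mult.left_commute)
  have "cf_mat (word a b c d (Suc h)) = mmul (T11 h, T12 h, T21 h, T22 h)
     (u * (a * b * c + a + c) + v, u * (a * b + 1), u * (b * c + 1), u * b + v)"
    using cf_mat_append[of "word a b c d h @ [a, d, c]" "concat (replicate (3 * 4 ^ h) [a, b, c])"]
    unfolding cf_mat_word_adc R by simp
  then have A1: "A_seq a b c d (word_len (Suc h) - 1)
        = T11 h * (u * (a * b * c + a + c) + v) + T12 h * (u * (b * c + 1))"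
    and A2: "A_seq a b c d (word_len (Suc h) - 2)
        = T11 h * (u * (a * b + 1)) + T12 h * (u * b + v)"
    and B1: "B_seq a b c d (word_len (Suc h) - 1)
        = T21 h * (u * (a * b * c + a + c) + v) + T22 h * (u * (b * c + 1))"
    and B2: "B_seq a b c d (word_len (Suc h) - 2)
        = T21 h * (u * (a * b + 1)) + T22 h * (u * b + v)"
    unfolding cf_mat_word mmul.simps prod.inject by blast+
  show ?thesis
    unfolding q_seq_def q_seq_alt_def D_seq_eq x_seq_def y_seq_def z_seq_def v_seq_def A1 A2 B1 B2
    by (rule twisted_symmetry[OF sym])
qed

section \<open>Size of \<open>q_h\<close> and of its distances for alpha and its inverse\<close>

abbreviation "F \<equiv> 2 * (a * b + b * c + 2) * Q"

lemma T11_eq: "T11 h = continuant (word a b c d h @ [a, d, c])"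
  unfolding continuant_def cf_mat_word_adc by simp

lemma T_bounds: "T12 h \<le> T11 h" "T21 h \<le> T11 h" "T22 h \<le> T11 h"
  using cf_mat_bounds[OF _ _ cf_mat_word_adc[of h]] word_pos[of h] pos by force+

text \<open>The constant \<open>F\<close> comes from here: s + t is at most ab + bc + 2, and
  appending adc multiplies the continuant by at most \<open>2 * Q\<close>.\<close>

lemma coef_comb_le:
  assumes "m \<le> T11 h" "n \<le> T11 h"
  shows "s_coef a b c * m + t_coef a b c * n \<le> F * W h"
proof -
  have "s_coef a b c * m + t_coef a b c * n \<le> (b * c + 1) * T11 h + (a * b + 1) * T11 h"
    using assms by (intro add_mono mult_mono) (auto simp: s_coef_def t_coef_def)
  also have "\<dots> = (a * b + b * c + 2) * T11 h" by (simp add: algebra_simps)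
  also have "\<dots> \<le> (a * b + b * c + 2) * (2 * Q * W h)"
    unfolding T11_eq by (intro mult_left_mono W_adc_le) simp
  also have "\<dots> = F * W h" by (simp only: mult_ac)
  finally show ?thesis .
qed

lemma xy_le: "x_seq a b c d h + y_seq a b c d h \<le> F * W h"
  unfolding x_seq_def y_seq_def by (intro coef_comb_le T_bounds order_refl)

lemma zv_le: "z_seq a b c d h + v_seq a b c d h \<le> F * W h"
  unfolding z_seq_def v_seq_def by (intro coef_comb_le T_bounds)

lemma W_eq: "W h = A_seq a b c d (word_len h - 1)"
  by (simp add: continuant_def cf_mat_word)

lemma B_bounds:
  "B_seq a b c d (word_len h - 1) \<ge> 1"
  "B_seq a b c d (word_len h - 1) \<le> W h"
  "B_seq a b c d (word_len h - 2) \<le> W h"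
  "W h \<le> (a + 1) * B_seq a b c d (word_len h - 1)"
  using cf_mat_bounds[OF word_nonempty word_pos cf_mat_word[of h]] unfolding W_eq hd_word by auto

lemma q_seq_le: "q_seq a b c d h \<le> F * W h * W (Suc h)"
proof -
  have "q_seq a b c d h \<le> x_seq a b c d h * W (Suc h) + y_seq a b c d h * W (Suc h)"
    unfolding q_seq_def by (intro add_mono mult_left_mono B_bounds) auto
  also have "\<dots> = (x_seq a b c d h + y_seq a b c d h) * W (Suc h)" by (simp add: algebra_simps)
  also have "\<dots> \<le> F * W h * W (Suc h)" by (intro mult_right_mono xy_le) simp
  finally show ?thesis .
qed

text \<open>The summand containing \<open>y_h\<close> alone is already at least
  \<open>W h\<close>.\<close>

lemma q_seq_ge: "q_seq a b c d h \<ge> 2 ^ 4 ^ h"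
proof -
  have "t_coef a b c \<ge> 1"
    unfolding t_coef_def
    by (metis One_nat_def Suc_leI add_is_0 div_greater_zero_iff gcd_le1_nat gcd_pos_nat one_neq_zero)
  then have "1 * (W h * 1) * 1 \<le> t_coef a b c * (W h * Q) * B_seq a b c d (word_len (Suc h) - 1)"
    using Q_pos B_bounds(1)[of "Suc h"] by (intro mult_mono) auto
  also have "\<dots> \<le> t_coef a b c * T11 h * B_seq a b c d (word_len (Suc h) - 1)"
    using continuant_append_ge[of "word a b c d h" "[a, d, c]"]
    unfolding T11_eq continuant_adc by (intro mult_mono) auto
  also have "\<dots> \<le> q_seq a b c d h" by (simp only: q_seq_def y_seq_def le_add2)
  finally show ?thesis using W_ge[of h] by simp
qed

lemma alpha_ge_1: "alpha a b c d \<ge> 1"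
  using cf_value_ge[of "word_lim a b c d"] word_lim_pos
  unfolding alpha_def by (metis of_nat_1 of_nat_le_iff order_trans)

text \<open>Both errors are at most \<open>1 / B (n - 1)\<close>, which is at most
  \<open>(a + 1) / W (Suc h)\<close>. The weights are kept general so that the estimate serves x, y
  for alpha and z, v for its inverse.\<close>

lemma combination_le:
  assumes "e + f \<le> F * W h"
  defines "n \<equiv> word_len (Suc h)"
  shows "\<bar>real e * (real (B_seq a b c d (n - 2)) * alpha a b c d - real (A_seq a b c d (n - 2)))
        + real f * (real (B_seq a b c d (n - 1)) * alpha a b c d - real (A_seq a b c d (n - 1)))\<bar>
      \<le> real ((a + 1) * F * W h) / real (W (Suc h))" (is "\<bar>_ * ?u + _ * ?v\<bar> \<le> _")
proof -
  have n: "Suc (n - 2) = n - 1" "Suc (n - 1) = n"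
    using word_len_ge[of "Suc h"] by (auto simp: n_def)
  let ?B = "B_seq a b c d (n - 1)"
  have B: "?B \<ge> 1" "W (Suc h) \<le> (a + 1) * ?B" unfolding n_def by (rule B_bounds)+
  have W: "W (Suc h) \<ge> 1" using continuant_pos word_nonempty word_pos by blast
  have u: "\<bar>?u\<bar> \<le> 1 / real ?B"
    using cf_approx[OF word_lim_pos, where n = "n - 2"] unfolding n A_seq_def B_seq_def alpha_def .
  have "\<bar>?v\<bar> \<le> 1 / real (B_seq a b c d n)"
    using cf_approx[OF word_lim_pos, where n = "n - 1"] unfolding n A_seq_def B_seq_def alpha_def .
  also have "\<dots> \<le> 1 / real ?B"
    unfolding B_seq_def
    using cf_den_mono[of "word_lim a b c d" "n - 1", OF word_lim_pos]
      cf_den_pos[of "word_lim a b c d", OF word_lim_pos] n(2)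
    by (intro divide_left_mono) auto
  finally have v: "\<bar>?v\<bar> \<le> 1 / real ?B" .
  have "\<bar>real e * ?u + real f * ?v\<bar> \<le> real e * \<bar>?u\<bar> + real f * \<bar>?v\<bar>"
    by (rule order_trans[OF abs_triangle_ineq]) (simp add: abs_mult)
  also have "\<dots> \<le> real e * (1 / real ?B) + real f * (1 / real ?B)"
    using u v by (intro add_mono mult_left_mono) auto
  also have "\<dots> = real (e + f) / real ?B" by (simp add: add_divide_distrib)
  also have "\<dots> \<le> real (F * W h) / real ?B"
    using assms(1) by (intro divide_right_mono of_nat_mono) auto
  also have "\<dots> \<le> real ((a + 1) * F * W h) / real (W (Suc h))"
  proof -
    have "F * W h * W (Suc h) \<le> F * W h * ((a + 1) * ?B)" using B by (intro mult_left_mono) auto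
    then have "real (F * W h * W (Suc h)) \<le> real ((a + 1) * F * W h * ?B)"
      by (intro of_nat_mono) (simp only: mult_ac)
    then have "real (F * W h) * real (W (Suc h)) \<le> real ((a + 1) * F * W h) * real ?B"
      by (simp only: of_nat_mult)
    moreover have "p / y \<le> r / w" if "p * w \<le> r * y" "y > 0" "w > 0" for p r w y :: real
      using that by (simp add: field_simps)
    ultimately show ?thesis using B W by auto
  qed
  finally show ?thesis .
qed

lemma nint_dist_alpha_le:
  "nint_dist (real (q_seq a b c d h) * alpha a b c d) \<le> real ((a + 1) * F * W h) / real (W (Suc h))"
proof -
  let ?n = "word_len (Suc h)"
  let ?k = "int (x_seq a b c d h * A_seq a b c d (?n - 2) + y_seq a b c d h * A_seq a b c d (?n - 1))"
  have "real (q_seq a b c d h) * alpha a b c d - of_int ?k =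
     real (x_seq a b c d h) * (real (B_seq a b c d (?n - 2)) * alpha a b c d - real (A_seq a b c d (?n - 2)))
   + real (y_seq a b c d h) * (real (B_seq a b c d (?n - 1)) * alpha a b c d - real (A_seq a b c d (?n - 1)))"
    by (simp add: q_seq_def algebra_simps)
  then show ?thesis
    using nint_dist_le[of "real (q_seq a b c d h) * alpha a b c d" ?k] combination_le[OF xy_le, of h]
    by linarith
qed

text \<open>In the second expression for \<open>q_h\<close> the numerators appear, so dividing by
  alpha and subtracting the matching combination of denominators leaves minus the same kind of
  error, divided by alpha. Since alpha is at least 1, the division does no harm.\<close>

lemma nint_dist_inverse_alpha_le:
  "nint_dist (real (q_seq a b c d h) * inverse (alpha a b c d))
     \<le> real ((a + 1) * F * W h) / real (W (Suc h))"
proof -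
  let ?n = "word_len (Suc h)"
  let ?k = "int (z_seq a b c d h * B_seq a b c d (?n - 2) + v_seq a b c d h * B_seq a b c d (?n - 1))"
  let ?c = "real (z_seq a b c d h) * (real (B_seq a b c d (?n - 2)) * alpha a b c d - real (A_seq a b c d (?n - 2)))
   + real (v_seq a b c d h) * (real (B_seq a b c d (?n - 1)) * alpha a b c d - real (A_seq a b c d (?n - 1)))"
  have "real (q_seq a b c d h) * inverse (alpha a b c d) - of_int ?k = - ?c / alpha a b c d"
    unfolding q_seq_eq_alt q_seq_alt_def D_seq_eq using alpha_ge_1 by (simp add: field_simps)
  then have "\<bar>real (q_seq a b c d h) * inverse (alpha a b c d) - of_int ?k\<bar> = \<bar>?c\<bar> / alpha a b c d"
    by (simp only: abs_divide abs_minus_cancel) (use alpha_ge_1 in simp)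
  also have "\<dots> \<le> \<bar>?c\<bar>"
    using alpha_ge_1 mult_left_mono[OF alpha_ge_1, of "\<bar>?c\<bar>"] by (simp add: divide_le_eq)
  finally show ?thesis
    using nint_dist_le[of "real (q_seq a b c d h) * inverse (alpha a b c d)" ?k]
      combination_le[OF zv_le, of h]
    by linarith
qed

end

section \<open>The exponents\<close>

text \<open>The factors are \<open>a + 1\<close>, \<open>F\<close> and the growth constant
  \<open>4 * Q\<close>. The square makes the 5h-th power a 10h-th power of their product, enough to
  absorb the exponents 5, 8 and 6h with which they occur in \<open>gamma_estimate\<close>.\<close>

definition gamma_nat :: "nat \<Rightarrow> nat \<Rightarrow> nat \<Rightarrow> nat \<Rightarrow> nat" where
  "gamma_nat a b c d = ((a + 1) * (2 * (a * b + b * c + 2) * A2_hat a c d) * (4 * A2_hat a c d)) ^ 2"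

text \<open>The hypothesis is the fifth power of the claim, because
  \<open>q powr (ln g / ln q)\<close> is \<open>g\<close>. This leaves only natural exponents to be
  estimated.\<close>

lemma le_inverse_powr:
  fixes N q g :: real
  assumes "N \<ge> 0" "q > 1" "g > 0" "N ^ 5 * q ^ 3 \<le> g ^ (5 * h)"
  shows "N \<le> 1 / q powr (3 / 5 - real h * (ln g / ln q))"
proof -
  let ?e = "3 / 5 - real h * (ln g / ln q)"
  have g: "q powr (real (5 * h) * (ln g / ln q)) = g ^ (5 * h)"
    using assms by (simp add: powr_def exp_of_nat_mult del: of_nat_mult)
  have "(1 / q powr ?e) ^ 5 = 1 / q powr (5 * ?e)"
    using assms by (simp add: power_divide powr_power mult.commute)
  also have "5 * ?e = 3 - real (5 * h) * (ln g / ln q)" by simp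
  also have "1 / q powr \<dots> = g ^ (5 * h) / q ^ 3"
    using assms unfolding powr_diff g by (simp add: powr_numeral)
  finally have e: "(1 / q powr ?e) ^ 5 = g ^ (5 * h) / q ^ 3" .
  have "N ^ Suc 4 \<le> (1 / q powr ?e) ^ Suc 4"
    using assms e by (simp add: pos_le_divide_eq eval_nat_numeral)
  then show ?thesis by (rule power_le_imp_le_base) simp
qed

lemma mult_inverse_powr:
  fixes q :: real
  assumes "q > 0"
  shows "q * (1 / q powr (3 / 5 - e)) * (1 / q powr (3 / 5 - e)) = 1 / q powr (1 / 5 - 2 * e)"
proof -
  have "q * (1 / q powr (3 / 5 - e)) * (1 / q powr (3 / 5 - e))
      = q powr 1 * q powr - (3 / 5 - e) * q powr - (3 / 5 - e)"
    unfolding powr_minus_divide using assms by simp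
  also have "\<dots> = q powr (1 - (3 / 5 - e) - (3 / 5 - e))"
    by (simp only: powr_add[symmetric] diff_conv_add_uminus)
  also have "1 - (3 / 5 - e) - (3 / 5 - e) = - (1 / 5 - 2 * e)" by simp
  finally show ?thesis unfolding powr_minus_divide .
qed

context positive_letters
begin

text \<open>With X = \<open>W h\<close> and Y = \<open>W (Suc h)\<close>, the distances are O(X/Y)
  and \<open>q_h\<close> is O(XY), so the left side is O(X^8/Y^2). The square of
  \<open>W_power4_le\<close> bounds this; that is the source of the exponent 3/5.\<close>

lemma gamma_estimate:
  assumes "h \<ge> 1"
  shows "(real ((a + 1) * F * W h) / real (W (Suc h))) ^ 5 * real (q_seq a b c d h) ^ 3
      \<le> real (gamma_nat a b c d) ^ (5 * h)"
proof -
  let ?X = "W h" and ?Y = "W (Suc h)" and ?C = "4 * Q" and ?E = "(a + 1) * F * (4 * Q)"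
  have Y: "?Y \<ge> 1" using continuant_pos word_nonempty word_pos by blast
  have F1: "F \<ge> 1" and C1: "?C \<ge> 1" using Q_pos by auto
  have "?X ^ 8 = (?X ^ 4) ^ 2" by simp
  also have "\<dots> \<le> (?C ^ (3 * h) * ?Y) ^ 2" by (intro power_mono W_power4_le) simp
  also have "\<dots> = ?C ^ (6 * h) * ?Y ^ 2"
    by (simp add: power_mult_distrib power_mult[symmetric] mult.commute)
  finally have X8: "?X ^ 8 \<le> ?C ^ (6 * h) * ?Y ^ 2" .
  \<comment> \<open>All exponents are raised to 10h, which is possible since h is at least
    1.\<close>
  have "(a + 1) ^ 5 * F ^ 8 * ?X ^ 8 \<le> (a + 1) ^ (10 * h) * F ^ (10 * h) * (?C ^ (10 * h) * ?Y ^ 2)"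
  proof (intro mult_mono)
    show "?X ^ 8 \<le> ?C ^ (10 * h) * ?Y ^ 2"
      using C1 by (intro order_trans[OF X8] mult_right_mono power_increasing) auto
  qed (use assms F1 in \<open>auto intro!: power_increasing\<close>)
  also have "\<dots> = ?E ^ (10 * h) * ?Y ^ 2"
    unfolding power_mult_distrib[of "(a + 1) * F"] power_mult_distrib[of "a + 1"] by (simp only: mult.assoc)
  also have "?E ^ (10 * h) = gamma_nat a b c d ^ (5 * h)"
    unfolding gamma_nat_def power_mult[symmetric] by simp
  finally have main: "real ((a + 1) ^ 5 * F ^ 8 * ?X ^ 8) \<le> real (gamma_nat a b c d ^ (5 * h) * ?Y ^ 2)"
    by (rule of_nat_mono)
  have "(real ((a + 1) * F * ?X) / real ?Y) ^ 5 * real (q_seq a b c d h) ^ 3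
     \<le> (real ((a + 1) * F * ?X) / real ?Y) ^ 5 * real (F * ?X * ?Y) ^ 3"
    by (intro mult_left_mono power_mono of_nat_mono q_seq_le) auto
  also have "\<dots> = real ((a + 1) ^ 5 * F ^ 8 * ?X ^ 8) / real ?Y ^ 2"
  proof -
    have "(u * f * x / y) ^ 5 * (f * x * y) ^ 3 = u ^ 5 * f ^ 8 * x ^ 8 / y ^ 2"
      if "y \<noteq> 0" for u f x y :: real
      using that by (simp add: field_simps eval_nat_numeral)
    from this[of "real ?Y" "real (a + 1)" "real F" "real ?X"] Y
    show ?thesis unfolding of_nat_mult of_nat_power by simp
  qed
  also have "\<dots> \<le> real (gamma_nat a b c d ^ (5 * h) * ?Y ^ 2) / real ?Y ^ 2"
    by (intro divide_right_mono main) simp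
  also have "\<dots> = real (gamma_nat a b c d) ^ (5 * h)" using Y by simp
  finally show ?thesis .
qed

lemma gamma_gt_1: "gamma_nat a b c d > 1"
proof -
  have "1 * 1 * 4 \<le> (a + 1) * F * (4 * Q)"
    using Q_pos by (intro mult_le_mono) auto
  then show ?thesis unfolding gamma_nat_def by (intro one_less_power) linarith+
qed

lemma q_seq_gt_1: "q_seq a b c d h > 1"
  by (rule less_le_trans[OF one_less_power q_seq_ge]) auto

lemma nint_bounds:
  assumes "h \<ge> 1"
  defines "q \<equiv> real (q_seq a b c d h)"
  defines "\<delta> \<equiv> real h * (ln (real (gamma_nat a b c d)) / ln q)"
  shows "nint_dist (q * alpha a b c d) \<le> 1 / q powr (3 / 5 - \<delta>)"
    and "nint_dist (q * inverse (alpha a b c d)) \<le> 1 / q powr (3 / 5 - \<delta>)"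
    and "q * nint_dist (q * alpha a b c d) * nint_dist (q * inverse (alpha a b c d))
           \<le> 1 / q powr (1 / 5 - 2 * \<delta>)"
proof -
  have q: "q > 1" using q_seq_gt_1 by (simp add: q_def)
  have "real ((a + 1) * F * W h) / real (W (Suc h)) \<le> 1 / q powr (3 / 5 - \<delta>)"
    unfolding \<delta>_def
    by (rule le_inverse_powr) (use q gamma_gt_1 gamma_estimate[OF assms(1)] in \<open>auto simp: q_def\<close>)
  then show 1: "nint_dist (q * alpha a b c d) \<le> 1 / q powr (3 / 5 - \<delta>)"
    and 2: "nint_dist (q * inverse (alpha a b c d)) \<le> 1 / q powr (3 / 5 - \<delta>)"
    using nint_dist_alpha_le[of h] nint_dist_inverse_alpha_le[of h] unfolding q_def by linarith+
  have "q * nint_dist (q * alpha a b c d) * nint_dist (q * inverse (alpha a b c d))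
      \<le> q * (1 / q powr (3 / 5 - \<delta>)) * (1 / q powr (3 / 5 - \<delta>))"
    using q 1 2 by (intro mult_mono mult_left_mono) (auto simp: nint_dist_nonneg)
  also have "\<dots> = 1 / q powr (1 / 5 - 2 * \<delta>)" using q by (intro mult_inverse_powr) simp
  finally show "q * nint_dist (q * alpha a b c d) * nint_dist (q * inverse (alpha a b c d))
           \<le> 1 / q powr (1 / 5 - 2 * \<delta>)" .
qed

text \<open>Along \<open>q_h\<close> the product is at most an exponential in h divided by a doubly
  exponential quantity, so it tends to 0. As \<open>q_h\<close> tends to infinity, this subsequence
  determines the lower limit.\<close>

lemma littlewood:
  "liminf (\<lambda>q::nat. ereal (real q * nint_dist (real q * alpha a b c d)
                                     * nint_dist (real q * inverse (alpha a b c d)))) = 0"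
proof -
  define f where "f q = real q * nint_dist (real q * alpha a b c d)
                          * nint_dist (real q * inverse (alpha a b c d))" for q :: nat
  define g where "g = real (gamma_nat a b c d)"
  define q where "q = q_seq a b c d"
  have f0: "f n \<ge> 0" for n by (simp add: f_def nint_dist_nonneg)
  have g: "g > 1" using gamma_gt_1 by (simp add: g_def)
  have qge: "real (q h) \<ge> 2 ^ 4 ^ h" for h
    using q_seq_ge[of h] unfolding q_def by (metis of_nat_le_iff of_nat_numeral of_nat_power)
  have bound: "f (q h) \<le> g powr (2 * real h) / 2 powr (4 powr real h / 5)" if "h \<ge> 1" for h
  proof -
    let ?q = "real (q h)"
    have q1: "?q > 1" using q_seq_gt_1 by (simp add: q_def)
    \<comment> \<open>The loss from the exponent delta does not depend on the size of
      \<open>q_h\<close>: it is a pure power of \<open>g\<close>.\<close>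
    have "?q powr (real h * (ln g / ln ?q)) = g powr real h"
      using q1 g by (simp add: powr_def)
    moreover have "2 * (real h * (ln g / ln ?q)) = real h * (ln g / ln ?q) + real h * (ln g / ln ?q)"
      by simp
    ultimately have gp: "?q powr (2 * (real h * (ln g / ln ?q))) = g powr (2 * real h)"
      by (metis mult_2 powr_add)
    have "f (q h) \<le> 1 / ?q powr (1 / 5 - 2 * (real h * (ln g / ln ?q)))"
      using nint_bounds(3)[OF that] by (simp add: f_def q_def g_def)
    also have "\<dots> = g powr (2 * real h) / ?q powr (1 / 5)"
      unfolding powr_diff gp by simp
    also have "\<dots> \<le> g powr (2 * real h) / (2 ^ 4 ^ h) powr (1 / 5)"
      using qge[of h] q1 by (intro divide_left_mono powr_mono2 mult_pos_pos) auto
    also have "(2 ^ 4 ^ h :: real) powr (1 / 5) = 2 powr (4 powr real h / 5)"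
      by (simp add: powr_realpow[symmetric] powr_powr)
    finally show ?thesis .
  qed
  have "(\<lambda>h. g powr (2 * real h) / 2 powr (4 powr real h / 5)) \<longlonglongrightarrow> 0"
    using g by real_asymp
  then have lim: "(\<lambda>h. f (q h)) \<longlonglongrightarrow> 0"
  proof (rule tendsto_sandwich[where f = "\<lambda>_. 0", rotated 3])
    show "\<forall>\<^sub>F h in sequentially. f (q h) \<le> g powr (2 * real h) / 2 powr (4 powr real h / 5)"
      using eventually_ge_at_top[of 1] by eventually_elim (rule bound)
  qed (simp_all add: f0)
  have "q h \<ge> h" for h
  proof -
    have "h \<le> 2 ^ h" using less_exp[of h] by simp
    also have "\<dots> \<le> 4 ^ h" by (intro power_mono) auto
    also have "\<dots> \<le> 2 ^ 4 ^ h" by (intro less_imp_le less_exp)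
    also have "\<dots> \<le> q h" unfolding q_def by (rule q_seq_ge)
    finally show ?thesis .
  qed
  then have q_top: "filterlim q at_top sequentially"
    by (intro filterlim_at_top_mono[OF filterlim_ident]) auto
  \<comment> \<open>A positive lower limit would keep \<open>f\<close> eventually above some
    \<open>e > 0\<close>, hence also along \<open>q_h\<close>.\<close>
  have "\<not> 0 < liminf (\<lambda>n. ereal (f n))"
  proof
    assume "0 < liminf (\<lambda>n. ereal (f n))"
    then obtain e where e: "0 < ereal e" "ereal e < liminf (\<lambda>n. ereal (f n))"
      using ereal_dense2 by blast
    from less_LiminfD[OF e(2)] have "\<forall>\<^sub>F n in sequentially. ereal e < ereal (f n)" .
    then have "\<forall>\<^sub>F n in sequentially. e < f n" by simp
    then have "\<forall>\<^sub>F h in sequentially. e < f (q h)"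
      using q_top unfolding filterlim_iff by blast
    moreover have "\<forall>\<^sub>F h in sequentially. f (q h) < e"
      using lim e by (intro order_tendstoD) auto
    ultimately have "\<forall>\<^sub>F h :: nat in sequentially. False" by eventually_elim simp
    then show False by simp
  qed
  moreover have "0 \<le> liminf (\<lambda>n. ereal (f n))"
    by (intro Liminf_bounded always_eventually) (simp add: f0)
  ultimately show ?thesis unfolding f_def by (simp add: antisym)
qed

end

section \<open>Effectivity\<close>

text \<open>Unlike \<^const>\<open>total_recursive\<close>, this ignores the values on lists of the wrong length.\<close>

definition computable :: "nat \<Rightarrow> (nat list \<Rightarrow> nat) \<Rightarrow> bool" where
  "computable n f \<longleftrightarrow> (\<exists>g. total_recursive n g \<and> (\<forall>xs. length xs = n \<longrightarrow> g xs = f xs))"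

lemma computable_proj: "i < n \<Longrightarrow> computable n (\<lambda>xs. xs ! i)"
  unfolding computable_def using total_recursive.proj by blast

lemma computable_comp1:
  assumes "computable 1 f" "computable n g"
  shows "computable n (\<lambda>xs. f [g xs])"
proof -
  obtain f' g' where f': "total_recursive 1 f'" "\<And>xs. length xs = 1 \<Longrightarrow> f' xs = f xs"
    and g': "total_recursive n g'" "\<And>xs. length xs = n \<Longrightarrow> g' xs = g xs"
    using assms unfolding computable_def by blast
  have "total_recursive n (\<lambda>xs. f' (map (\<lambda>g. g xs) [g']))"
    using f'(1) g'(1) by (intro total_recursive.comp) auto
  then show ?thesis unfolding computable_def using f'(2) g'(2) by (intro exI conjI) auto
qed

lemma computable_comp2:
  assumes "computable 2 f" "computable n g" "computable n h"
  shows "computable n (\<lambda>xs. f [g xs, h xs])"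
proof -
  obtain f' g' h' where f': "total_recursive 2 f'" "\<And>xs. length xs = 2 \<Longrightarrow> f' xs = f xs"
    and g': "total_recursive n g'" "\<And>xs. length xs = n \<Longrightarrow> g' xs = g xs"
    and h': "total_recursive n h'" "\<And>xs. length xs = n \<Longrightarrow> h' xs = h xs"
    using assms unfolding computable_def by blast
  have "total_recursive n (\<lambda>xs. f' (map (\<lambda>g. g xs) [g', h']))"
    using f'(1) g'(1) h'(1) by (intro total_recursive.comp) (auto simp: numeral_2_eq_2)
  then show ?thesis unfolding computable_def using f'(2) g'(2) h'(2) by (intro exI conjI) auto
qed

text \<open>Recursion on the first argument with the second as parameter yields addition and
  multiplication, which is all that a polynomial such as \<open>gamma_nat\<close> needs.\<close>

lemma computable_rec2:
  assumes "computable 1 f" "computable 3 g"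
  shows "computable 2 (\<lambda>xs. rec_nat (f [xs ! 1]) (\<lambda>k r. g [k, r, xs ! 1]) (xs ! 0))"
proof -
  obtain f' g' where f': "total_recursive 1 f'" "\<And>xs. length xs = 1 \<Longrightarrow> f' xs = f xs"
    and g': "total_recursive 3 g'" "\<And>xs. length xs = 3 \<Longrightarrow> g' xs = g xs"
    using assms unfolding computable_def by blast
  have "total_recursive (Suc 1) (\<lambda>xs. rec_nat (f' (tl xs)) (\<lambda>k r. g' (k # r # tl xs)) (hd xs))"
    using total_recursive.prim_rec[of 1 f' g'] f'(1) g'(1) by (simp add: numeral_3_eq_3)
  moreover have "rec_nat (f' (tl xs)) (\<lambda>k r. g' (k # r # tl xs)) (hd xs)
      = rec_nat (f [xs ! 1]) (\<lambda>k r. g [k, r, xs ! 1]) (xs ! 0)" if "length xs = 2" for xs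
  proof -
    obtain x y where "xs = [x, y]" using \<open>length xs = 2\<close> by (auto simp: length_Suc_conv numeral_2_eq_2)
    then show ?thesis using f'(2) g'(2) by simp
  qed
  ultimately show ?thesis unfolding computable_def Suc_1 by blast
qed

lemma computable_Suc:
  assumes "computable n f"
  shows "computable n (\<lambda>xs. Suc (f xs))"
proof -
  have "computable 1 (\<lambda>xs. Suc (xs ! 0))"
    unfolding computable_def using total_recursive.succ by blast
  from computable_comp1[OF this assms] show ?thesis by simp
qed

lemma computable_const: "computable n (\<lambda>xs. k)"
proof (induction k)
  case 0
  show ?case unfolding computable_def using total_recursive.zero by blast
qed (rule computable_Suc)

lemma computable_add:
  assumes "computable n f" "computable n g"
  shows "computable n (\<lambda>xs. f xs + g xs)"
proof -
  have "rec_nat y (\<lambda>k. Suc) x = x + y" for x y by (induction x) auto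
  then have "computable 2 (\<lambda>xs. xs ! 0 + xs ! 1)"
    using computable_rec2[OF computable_proj[of 0] computable_Suc[OF computable_proj[of 1]]] by simp
  from computable_comp2[OF this assms] show ?thesis by simp
qed

lemma computable_mult:
  assumes "computable n f" "computable n g"
  shows "computable n (\<lambda>xs. f xs * g xs)"
proof -
  have "rec_nat 0 (\<lambda>k r. r + y) x = x * y" for x y :: nat by (induction x) auto
  then have "computable 2 (\<lambda>xs. xs ! 0 * xs ! 1)"
    using computable_rec2[OF computable_const[of 1 0] computable_add[OF computable_proj[of 1] computable_proj[of 2]]]
    by simp
  from computable_comp2[OF this assms] show ?thesis by simp
qed

lemma effectively_determined_gamma: "effectively_determined (\<lambda>a b c d. real (gamma_nat a b c d))"
proof -
  \<comment> \<open>The factor \<open>m + 1\<close> cancels the denominator in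
    \<open>effectively_determined\<close>, so the approximation is exact at every accuracy.\<close>
  have "computable 5 (\<lambda>xs. gamma_nat (xs ! 0) (xs ! 1) (xs ! 2) (xs ! 3) * Suc (xs ! 4))"
    unfolding gamma_nat_def A2_hat_def power2_eq_square
    by (intro computable_mult computable_add computable_Suc computable_proj computable_const) simp_all
  then obtain f where f: "total_recursive 5 f"
    "\<And>xs. length xs = 5 \<Longrightarrow> f xs = gamma_nat (xs ! 0) (xs ! 1) (xs ! 2) (xs ! 3) * Suc (xs ! 4)"
    unfolding computable_def by blast
  have "real (f [a, b, c, d, m]) / real (Suc m) = real (gamma_nat a b c d)" for a b c d m
    using f(2)[of "[a, b, c, d, m]"] by (simp del: mult_Suc_right of_nat_Suc)
  then show ?thesis
    unfolding effectively_determined_def using f(1) by (intro exI[of _ f]) simp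
qed

theorem theorem25:
  shows "\<exists>\<gamma> :: nat \<Rightarrow> nat \<Rightarrow> nat \<Rightarrow> nat \<Rightarrow> real. effectively_determined \<gamma> \<and>
    (\<forall>a b c d :: nat. a \<ge> 1 \<and> b \<ge> 1 \<and> c \<ge> 1 \<and> d \<ge> 1 \<and> distinct [a, b, c, d] \<longrightarrow>
      \<gamma> a b c d > 0 \<and>
      (\<forall>h::nat. h \<ge> 1 \<longrightarrow>
        (let \<alpha> = alpha a b c d;
             q = q_seq a b c d h;
             \<delta> = real h * (ln (\<gamma> a b c d) / ln (real q))
         in q = q_seq_alt a b c d h \<and>
            nint_dist (real q * \<alpha>) \<le> 1 / real q powr (3 / 5 - \<delta>) \<and>
            nint_dist (real q * inverse \<alpha>) \<le> 1 / real q powr (3 / 5 - \<delta>) \<and>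
            real q * nint_dist (real q * \<alpha>) * nint_dist (real q * inverse \<alpha>)
              \<le> 1 / real q powr (1 / 5 - 2 * \<delta>))) \<and>
      liminf (\<lambda>q::nat. ereal (real q * nint_dist (real q * alpha a b c d)
                                     * nint_dist (real q * inverse (alpha a b c d)))) = 0)"
proof (intro exI[of _ "\<lambda>a b c d. real (gamma_nat a b c d)"] conjI effectively_determined_gamma
    allI impI)
  fix a b c d :: nat
  assume "a \<ge> 1 \<and> b \<ge> 1 \<and> c \<ge> 1 \<and> d \<ge> 1 \<and> distinct [a, b, c, d]"
  then interpret positive_letters a b c d by unfold_locales auto
  show "real (gamma_nat a b c d) > 0" using gamma_gt_1 by simp
  show "liminf (\<lambda>q::nat. ereal (real q * nint_dist (real q * alpha a b c d)
                                     * nint_dist (real q * inverse (alpha a b c d)))) = 0"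
    by (rule littlewood)
  fix h :: nat
  assume "h \<ge> 1"
  then show "let \<alpha> = alpha a b c d;
             q = q_seq a b c d h;
             \<delta> = real h * (ln (real (gamma_nat a b c d)) / ln (real q))
         in q = q_seq_alt a b c d h \<and>
            nint_dist (real q * \<alpha>) \<le> 1 / real q powr (3 / 5 - \<delta>) \<and>
            nint_dist (real q * inverse \<alpha>) \<le> 1 / real q powr (3 / 5 - \<delta>) \<and>
            real q * nint_dist (real q * \<alpha>) * nint_dist (real q * inverse \<alpha>)
              \<le> 1 / real q powr (1 / 5 - 2 * \<delta>)"
    unfolding Let_def using q_seq_eq_alt nint_bounds by blast
qed

end
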